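(* Let $G=(V,E)$ be a complete directed graph with $n=|V|$ vertices and weights $w\in\mathbb{R}^E_{\ge0}$, and let $\varepsilon\ge0$. Put $c_e=\min\{\varepsilon,w_e\}$ for $e\in E$, $C=\sum_{e\in E}c_e$, and $W(H)=\sum_{e\in H}w_e$. Then for every Hamiltonian cycle $H\in\mathcal H$, $$\max_{(\Delta^+,\Delta^-)\in\mathcal D^{\mathrm{L},\infty}(\varepsilon)}\ \sum_{e\in H}\bigl(w_e+\Delta^+_e-\Delta^-_e\bigr)\le\min\Bigl\{W(H)+n\varepsilon,\ C+\sum_{e\in H}(w_e-c_e)\Bigr\}.$$ Consequently, $$\mathrm{OPT}_{\mathrm{RTSP}}\bigl(w,\mathcal D^{\mathrm{L},\infty}(\varepsilon)\bigr)\le\min\bigl\{\mathrm{OPT}(w)+n\varepsilon,\ C+\mathrm{OPT}(w-c)\bigr\}.$$ The quantities $c$, $w-c$, and $C$ can be computed in $O(|E|)$ time.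
   Context: Complete directed graph: one edge for each ordered pair of distinct vertices. $\mathcal H$ is the set of Hamiltonian cycles of $G$ (directed cycles visiting every vertex exactly once), identified with their edge sets. $E_{\mathrm{in}}(u)$ and $E_{\mathrm{out}}(u)$ are the edges entering/leaving $u$. $\mathcal D^{\mathrm{L},\infty}(\varepsilon)$ is the set of $(\Delta^+,\Delta^-)\in\mathbb{R}^{E}_{\ge0}\times\mathbb{R}^{E}_{\ge0}$ with $\sum_{e\in E_{\mathrm{in}}(u)}\Delta^-_e=\sum_{e\in E_{\mathrm{out}}(u)}\Delta^+_e$ for all $u\in V$, $\Delta^-\le w+\Delta^+$ entrywise, and all components at most $\varepsilon$. For weights $v\in\mathbb{R}^E_{\ge0}$, $\mathrm{OPT}(v)=\min_{H\in\mathcal H}\sum_{e\in H}v_e$ is the ordinary TSP value, and $\mathrm{OPT}_{\mathrm{RTSP}}(w,\mathcal D(\varepsilon))=\min_{H\in\mathcal H}\max_{(\Delta^+,\Delta^-)\in\mathcal D(\varepsilon)}\sum_{e\in H}(w_e+\Delta^+_e-\Delta^-_e)$. *)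

theory Defs
  imports
    "HOL-Analysis.Analysis"
    "HOL-Library.Landau_Symbols"
    "Graph_Theory.Graph_Theory"
    "Graph_Theory.Kuratowski"
begin

section \<open>Hamiltonian cycles and the travelling salesman problem\<close>

text \<open>
  Cycles are arc lists that repeat neither a vertex nor an arc (the notion of \<^theory>\<open>Graph_Theory.Arc_Walk\<close>);
  a Hamiltonian cycle is identified with its set of arcs. The start vertices of the arcs of a
  cycle are exactly the vertices on it. In a complete digraph on fewer than two vertices there is
  no Hamiltonian cycle.
\<close>

definition hamiltonian_cycles :: "('a, 'b) pre_digraph \<Rightarrow> 'b set set" where
  "hamiltonian_cycles G = {set p | p. pre_digraph.cycle G p \<and> tail G ` set p = verts G}"

definition opt_tsp :: "('a, 'b) pre_digraph \<Rightarrow> ('b \<Rightarrow> real) \<Rightarrow> real" where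
  "opt_tsp G v = Min ((\<lambda>H. \<Sum>e\<in>H. v e) ` hamiltonian_cycles G)"


section \<open>Robust travelling salesman problem\<close>

text \<open>A perturbation is a pair of increases and decreases, each a vector in
  \<open>arcs G \<rightarrow>\<^sub>E {0..}\<close>, the nonnegative orthant indexed by the arcs.\<close>

definition uncertainty_L_inf ::
    "('a, 'b) pre_digraph \<Rightarrow> ('b \<Rightarrow> real) \<Rightarrow> real \<Rightarrow> (('b \<Rightarrow> real) \<times> ('b \<Rightarrow> real)) set" where
  "uncertainty_L_inf G w \<epsilon> =
     {(\<Delta>p, \<Delta>m).
        \<Delta>p \<in> arcs G \<rightarrow>\<^sub>E {0..} \<and> \<Delta>m \<in> arcs G \<rightarrow>\<^sub>E {0..} \<and>
        (\<forall>u\<in>verts G. (\<Sum>e\<in>in_arcs G u. \<Delta>m e) = (\<Sum>e\<in>out_arcs G u. \<Delta>p e)) \<and>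
        (\<forall>e\<in>arcs G. \<Delta>m e \<le> w e + \<Delta>p e) \<and>
        (\<forall>e\<in>arcs G. \<Delta>p e \<le> \<epsilon> \<and> \<Delta>m e \<le> \<epsilon>)}"

text \<open>\<open>GREATEST\<close> denotes the maximum, not the supremum: nothing is known about it unless the maximum is
  attained.\<close>

definition robust_cost ::
    "('b \<Rightarrow> real) \<Rightarrow> (('b \<Rightarrow> real) \<times> ('b \<Rightarrow> real)) set \<Rightarrow> 'b set \<Rightarrow> real" where
  "robust_cost w D H =
     (GREATEST x. x \<in> (\<lambda>(\<Delta>p, \<Delta>m). \<Sum>e\<in>H. w e + \<Delta>p e - \<Delta>m e) ` D)"

definition opt_rtsp ::
    "('a, 'b) pre_digraph \<Rightarrow> ('b \<Rightarrow> real) \<Rightarrow> (('b \<Rightarrow> real) \<times> ('b \<Rightarrow> real)) set \<Rightarrow> real" where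
  "opt_rtsp G w D = Min (robust_cost w D ` hamiltonian_cycles G)"


section \<open>A real random access machine\<close>

text \<open>
  Running times refer to a unit-cost machine over the reals with indirect addressing. Natural number registers
  serve for addressing and loop control, real registers and an unbounded real memory for data.
  The only arithmetic is addition on naturals, addition and subtraction on reals, and comparison. The
  machine stops when the program counter leaves the program.
\<close>

datatype ram_instr =
    ISet nat nat              \<comment> \<open>\<open>ISet i k\<close>: natural register \<open>i\<close> becomes the constant \<open>k\<close>\<close>
  | IAdd nat nat nat          \<comment> \<open>\<open>IAdd i j k\<close>: register \<open>i\<close> becomes register \<open>j\<close> plus register \<open>k\<close>\<close>
  | IJumpLess nat nat nat     \<comment> \<open>\<open>IJumpLess i j l\<close>: go to \<open>l\<close> if register \<open>i\<close> < register \<open>j\<close>\<close>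
  | Jump nat
  | RAdd nat nat nat
  | RSub nat nat nat
  | RJumpLess nat nat nat
  | RLoad nat nat             \<comment> \<open>\<open>RLoad r i\<close>: the address is the content of natural register \<open>i\<close>\<close>
  | RStore nat nat            \<comment> \<open>\<open>RStore i r\<close>: likewise\<close>

record ram_state =
  counter :: nat
  nreg :: "nat \<Rightarrow> nat"
  rreg :: "nat \<Rightarrow> real"
  memory :: "nat \<Rightarrow> real"

fun exec_instr :: "ram_instr \<Rightarrow> ram_state \<Rightarrow> ram_state" where
  "exec_instr (ISet i k) s =
     s\<lparr>counter := counter s + 1, nreg := (nreg s)(i := k)\<rparr>"
| "exec_instr (IAdd i j k) s =
     s\<lparr>counter := counter s + 1, nreg := (nreg s)(i := nreg s j + nreg s k)\<rparr>"
| "exec_instr (IJumpLess i j l) s =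
     s\<lparr>counter := (if nreg s i < nreg s j then l else counter s + 1)\<rparr>"
| "exec_instr (Jump l) s = s\<lparr>counter := l\<rparr>"
| "exec_instr (RAdd i j k) s =
     s\<lparr>counter := counter s + 1, rreg := (rreg s)(i := rreg s j + rreg s k)\<rparr>"
| "exec_instr (RSub i j k) s =
     s\<lparr>counter := counter s + 1, rreg := (rreg s)(i := rreg s j - rreg s k)\<rparr>"
| "exec_instr (RJumpLess i j l) s =
     s\<lparr>counter := (if rreg s i < rreg s j then l else counter s + 1)\<rparr>"
| "exec_instr (RLoad r i) s =
     s\<lparr>counter := counter s + 1, rreg := (rreg s)(r := memory s (nreg s i))\<rparr>"
| "exec_instr (RStore i r) s =
     s\<lparr>counter := counter s + 1, memory := (memory s)(nreg s i := rreg s r)\<rparr>"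

definition ram_halted :: "ram_instr list \<Rightarrow> ram_state \<Rightarrow> bool" where
  "ram_halted P s \<longleftrightarrow> length P \<le> counter s"

definition ram_step :: "ram_instr list \<Rightarrow> ram_state \<Rightarrow> ram_state" where
  "ram_step P s = (if ram_halted P s then s else exec_instr (P ! counter s) s)"

definition ram_halts_within :: "ram_instr list \<Rightarrow> nat \<Rightarrow> ram_state \<Rightarrow> ram_state \<Rightarrow> bool" where
  "ram_halts_within P t s s' \<longleftrightarrow> (\<exists>k\<le>t. (ram_step P ^^ k) s = s' \<and> ram_halted P s')"

text \<open>Input convention: natural register \<open>0\<close> holds the number of weights, memory cell \<open>0\<close> holds \<open>\<epsilon>\<close>,
  the following cells hold the weights, everything else is zero.\<close>

definition ram_input :: "real \<Rightarrow> real list \<Rightarrow> ram_state" where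
  "ram_input \<epsilon> ws =
     \<lparr>counter = 0,
      nreg = (\<lambda>_. 0)(0 := length ws),
      rreg = (\<lambda>_. 0),
      memory = (\<lambda>a. if a = 0 then \<epsilon> else if a \<le> length ws then ws ! (a - 1) else 0)\<rparr>"

text \<open>Output convention: cell \<open>0\<close> holds \<open>C\<close>, the following cells the vector \<open>c\<close>, then the vector \<open>d\<close>.\<close>

definition ram_output :: "ram_state \<Rightarrow> real \<Rightarrow> real list \<Rightarrow> real list \<Rightarrow> bool" where
  "ram_output s C cs ds \<longleftrightarrow>
     memory s 0 = C \<and>
     (\<forall>i<length cs. memory s (1 + i) = cs ! i) \<and>
     (\<forall>i<length ds. memory s (1 + length cs + i) = ds ! i)"

end

theory Submission
  imports Defs
begin

text \<open>
  The first bound is the trivial one: a tour has at most \<open>n\<close> arcs, and no perturbation makes an arc dearer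
  by more than \<open>\<epsilon>\<close>. The second bound comes from conservation. Summing the local balance condition over all
  vertices gives \<open>\<Sum>\<Delta>p = \<Sum>\<Delta>m\<close> over all arcs, because every arc enters exactly one vertex and leaves exactly
  one. Hence whatever a perturbation adds to a tour it must take away outside the tour:
  \<open>\<Sum>(\<Delta>p - \<Delta>m)\<close> over the tour equals \<open>\<Sum>(\<Delta>m - \<Delta>p)\<close> over the remaining arcs. But the net decrease on an arc
  is at most \<open>\<epsilon>\<close> and at most \<open>w e\<close>, that is, at most \<open>min \<epsilon> (w e)\<close>; so the tour gains at most the truncated
  weight lying outside it. These are \<open>perturbed_cost_le_card\<close> and \<open>perturbed_cost_le_truncation\<close>.

  Both bounds are about individual perturbations. They pass to the robust cost because the maximum
  is attained (\<open>robust_cost_attained\<close>): the uncertainty set is a nonempty compact set and the cost is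
  continuous. They pass to the optima because both right-hand sides are a nonnegative constant plus
  the length of the tour for suitable weights (\<open>Min_image_le_add\<close>).

  The running time is witnessed by a loop that visits each weight once. One round takes at
  most eleven instructions, and five more set up and close the loop.
\<close>


section \<open>The cost of a tour under the worst perturbation\<close>

lemma (in fin_digraph) sum_in_arcs_verts:
  "(\<Sum>u\<in>verts G. \<Sum>e\<in>in_arcs G u. f e) = (\<Sum>e\<in>arcs G. f e)"
  unfolding in_arcs_def by (rule sum.group) auto

lemma (in fin_digraph) sum_out_arcs_verts:
  "(\<Sum>u\<in>verts G. \<Sum>e\<in>out_arcs G u. f e) = (\<Sum>e\<in>arcs G. f e)"
  unfolding out_arcs_def by (rule sum.group) auto

text \<open>Every arc has one head and one tail, so the balance conditions at the vertices add up to global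
  conservation.\<close>

lemma (in fin_digraph) uncertainty_L_inf_balanced:
  assumes "(p, m) \<in> uncertainty_L_inf G w \<epsilon>"
  shows "(\<Sum>e\<in>arcs G. m e) = (\<Sum>e\<in>arcs G. p e)"
proof -
  have "(\<Sum>u\<in>verts G. \<Sum>e\<in>in_arcs G u. m e) = (\<Sum>u\<in>verts G. \<Sum>e\<in>out_arcs G u. p e)"
    using assms unfolding uncertainty_L_inf_def by (intro sum.cong[OF refl]) blast
  then show ?thesis
    by (simp only: sum_in_arcs_verts sum_out_arcs_verts)
qed

lemma (in fin_digraph) perturbed_cost_le_card:
  assumes "(p, m) \<in> uncertainty_L_inf G w \<epsilon>" and "H \<subseteq> arcs G"
  shows "(\<Sum>e\<in>H. w e + p e - m e) \<le> (\<Sum>e\<in>H. w e) + real (card H) * \<epsilon>"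
proof -
  have "(\<Sum>e\<in>H. w e + p e - m e) \<le> (\<Sum>e\<in>H. w e + \<epsilon>)"
  proof (rule sum_mono)
    fix e assume "e \<in> H"
    then have e: "e \<in> arcs G" using assms(2) by blast
    have "p e \<le> \<epsilon>" "0 \<le> m e"
      using assms(1) e by (auto simp: uncertainty_L_inf_def dest!: PiE_mem)
    then show "w e + p e - m e \<le> w e + \<epsilon>" by simp
  qed
  then show ?thesis by (simp add: sum.distrib)
qed

text \<open>By conservation the net gain on \<open>H\<close> is the net loss off \<open>H\<close>, and no arc can lose more
  than its truncated weight.\<close>

lemma (in fin_digraph) perturbed_cost_le_truncation:
  assumes D: "(p, m) \<in> uncertainty_L_inf G w \<epsilon>" and H: "H \<subseteq> arcs G"
  shows "(\<Sum>e\<in>H. w e + p e - m e)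
    \<le> (\<Sum>e\<in>arcs G. min \<epsilon> (w e)) + (\<Sum>e\<in>H. w e - min \<epsilon> (w e))"
proof -
  let ?c = "\<lambda>e. min \<epsilon> (w e)"
  have split: "(\<Sum>e\<in>arcs G. f e) = (\<Sum>e\<in>arcs G - H. f e) + (\<Sum>e\<in>H. f e)" for f :: "'b \<Rightarrow> real"
    using H by (simp add: sum.subset_diff)
  have "(\<Sum>e\<in>H. p e - m e) = (\<Sum>e\<in>arcs G - H. m e - p e)"
    using uncertainty_L_inf_balanced[OF D] split[of m] split[of p]
    by (simp add: sum_subtractf)
  also have "\<dots> \<le> (\<Sum>e\<in>arcs G - H. ?c e)"
  proof (rule sum_mono)
    fix e assume "e \<in> arcs G - H"
    then have e: "e \<in> arcs G" by blast
    have "m e \<le> \<epsilon>" "0 \<le> p e" "m e \<le> w e + p e"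
      using D e by (auto simp: uncertainty_L_inf_def dest!: PiE_mem)
    then show "m e - p e \<le> ?c e" by simp
  qed
  finally show ?thesis
    using split[of ?c] by (simp add: sum.distrib sum_subtractf)
qed

text \<open>Outside \<open>I\<close> the functions in \<open>PiE I K\<close> take only the value \<open>undefined\<close>, so the set is a product of
  compact sets over the whole index type and Tychonoff's theorem applies.\<close>

lemma compact_PiE_extensional:
  fixes K :: "'i \<Rightarrow> 'x::topological_space set"
  assumes "\<And>i. i \<in> I \<Longrightarrow> compact (K i)"
  shows "compact (PiE I K)"
proof -
  have eq: "PiE I K = PiE UNIV (\<lambda>i. if i \<in> I then K i else {undefined})"
    by (force simp: PiE_def Pi_def extensional_def split: if_splits)
  have "compactin (product_topology (\<lambda>_. euclidean) UNIV) (PiE I K)"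
    unfolding eq compactin_PiE using assms by auto
  then show ?thesis
    by (simp add: euclidean_product_topology)
qed

text \<open>The box constraints cut out a product of intervals; the balance conditions and the bounds
  \<open>\<Delta>m e \<le> w e + \<Delta>p e\<close> are finitely many closed conditions on it.\<close>

lemma (in fin_digraph) compact_uncertainty_L_inf:
  "compact (uncertainty_L_inf G w \<epsilon>)"
proof -
  let ?K = "arcs G \<rightarrow>\<^sub>E {0..\<epsilon>}"
  let ?B = "{x :: ('b \<Rightarrow> real) \<times> ('b \<Rightarrow> real).
    \<forall>u\<in>verts G. (\<Sum>e\<in>in_arcs G u. snd x e) = (\<Sum>e\<in>out_arcs G u. fst x e)}"
  let ?L = "{x. \<forall>e\<in>arcs G. snd x e \<le> w e + fst x e}"
  have cont: "continuous_on UNIV (\<lambda>x::('b \<Rightarrow> real) \<times> ('b \<Rightarrow> real). fst x e)"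
    "continuous_on UNIV (\<lambda>x::('b \<Rightarrow> real) \<times> ('b \<Rightarrow> real). snd x e)" for e
    by (rule continuous_on_product_then_coordinatewise[OF continuous_on_fst[OF continuous_on_id]],
        rule continuous_on_product_then_coordinatewise[OF continuous_on_snd[OF continuous_on_id]])
  have "closed ?B"
    unfolding Collect_ball_eq
    by (rule closed_INT, rule ballI, rule closed_Collect_eq; rule continuous_on_sum; rule cont)
  moreover have "closed ?L"
    unfolding Collect_ball_eq
    by (rule closed_INT, rule ballI, rule closed_Collect_le)
      (rule cont, rule continuous_on_add[OF continuous_on_const cont(1)])
  moreover have "compact (?K \<times> ?K)"
    by (rule compact_Times; rule compact_PiE_extensional) (rule compact_Icc)+
  moreover have "uncertainty_L_inf G w \<epsilon> = (?K \<times> ?K) \<inter> (?B \<inter> ?L)"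
  proof (rule set_eqI)
    fix x :: "('b \<Rightarrow> real) \<times> ('b \<Rightarrow> real)"
    obtain p m where x: "x = (p, m)" by (rule prod.exhaust)
    show "x \<in> uncertainty_L_inf G w \<epsilon> \<longleftrightarrow> x \<in> (?K \<times> ?K) \<inter> (?B \<inter> ?L)"
      unfolding x uncertainty_L_inf_def PiE_iff mem_Collect_eq case_prod_conv Int_iff mem_Times_iff
        atLeastAtMost_iff atLeast_iff fst_conv snd_conv by blast
  qed
  ultimately show ?thesis
    by (simp only: compact_Int_closed closed_Int)
qed

lemma zero_mem_uncertainty_L_inf:
  assumes "\<forall>e\<in>arcs G. 0 \<le> w e" and "0 \<le> \<epsilon>"
  shows "(\<lambda>e\<in>arcs G. 0, \<lambda>e\<in>arcs G. 0) \<in> uncertainty_L_inf G w \<epsilon>"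
  using assms by (auto simp: uncertainty_L_inf_def in_arcs_def out_arcs_def)

text \<open>Without attainment \<open>robust_cost\<close> would be an unspecified number, and bounds on the costs of
  single perturbations would say nothing about it.\<close>

lemma (in fin_digraph) robust_cost_attained:
  assumes "\<forall>e\<in>arcs G. 0 \<le> w e" and "0 \<le> \<epsilon>"
  obtains p m where "(p, m) \<in> uncertainty_L_inf G w \<epsilon>"
    and "robust_cost w (uncertainty_L_inf G w \<epsilon>) H = (\<Sum>e\<in>H. w e + p e - m e)"
proof -
  let ?D = "uncertainty_L_inf G w \<epsilon>"
  let ?f = "\<lambda>(p, m). \<Sum>e\<in>H. w e + p e - m e"
  have "continuous_on ?D (\<lambda>x. \<Sum>e\<in>H. w e + fst x e - snd x e)"
    by (intro continuous_intros continuous_on_product_then_coordinatewise)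
  then have "compact (?f ` ?D)"
    by (intro compact_continuous_image compact_uncertainty_L_inf) (simp add: case_prod_unfold)
  moreover have "?f ` ?D \<noteq> {}"
    using zero_mem_uncertainty_L_inf[OF assms] by blast
  ultimately have "\<exists>x\<in>?f ` ?D. \<forall>y\<in>?f ` ?D. y \<le> x"
    by (rule compact_attains_sup)
  then obtain x where x: "x \<in> ?f ` ?D" "\<forall>y\<in>?f ` ?D. y \<le> x"
    by (rule bexE)
  then have "robust_cost w ?D H = x"
    unfolding robust_cost_def by (intro Greatest_equality) blast+
  moreover obtain y where "y \<in> ?D" "x = ?f y"
    using x(1) by (rule imageE)
  moreover obtain p m where "y = (p, m)"
    by (rule prod.exhaust)
  ultimately show thesis by (intro that[of p m]) auto
qed


section \<open>Optimal tours\<close>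

text \<open>The arcs of a cycle correspond to the vertices of its walk after the first one, and these
  are distinct.\<close>

lemma (in fin_digraph) hamiltonian_cycle_subset_card:
  assumes "H \<in> hamiltonian_cycles G"
  shows "H \<subseteq> arcs G" and "card H \<le> card (verts G)"
proof -
  obtain p u where H: "H = set p" and p: "awalk u p u" "distinct (tl (awalk_verts u p))"
    using assms by (auto simp: hamiltonian_cycles_def cycle_def)
  show "H \<subseteq> arcs G" using p(1) H by (simp add: awalk_def)
  have "card H \<le> length p" using H card_length by blast
  also have "\<dots> = card (set (tl (awalk_verts u p)))"
    using p(2) by (simp add: distinct_card length_awalk_verts)
  also have "\<dots> \<le> card (verts G)"
  proof (rule card_mono)
    have "set (awalk_verts u p) \<subseteq> verts G" using p(1) unfolding awalk_conv by blast
    then show "set (tl (awalk_verts u p)) \<subseteq> verts G"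
      using list.set_sel(2) by (metis subset_iff tl_Nil)
  qed simp
  finally show "card H \<le> card (verts G)" .
qed

lemma (in fin_digraph) finite_hamiltonian_cycles: "finite (hamiltonian_cycles G)"
proof (rule finite_subset)
  show "hamiltonian_cycles G \<subseteq> Pow (arcs G)"
    using hamiltonian_cycle_subset_card(1) by blast
qed simp

text \<open>A minimizer of \<open>g\<close> is a candidate for \<open>f\<close>. If \<open>S\<close> is empty, both sides contain the same unspecified
  minimum, which is where \<open>0 \<le> a\<close> enters; for tours this happens in a complete graph with fewer than two
  vertices.\<close>

lemma Min_image_le_add:
  fixes f g :: "'x \<Rightarrow> real"
  assumes "finite S" and "0 \<le> a" and "\<And>x. x \<in> S \<Longrightarrow> f x \<le> a + g x"
  shows "Min (f ` S) \<le> a + Min (g ` S)"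
proof (cases "S = {}")
  case False
  then have "Min (g ` S) \<in> g ` S"
    using assms(1) by (intro Min_in) auto
  then obtain x where "Min (g ` S) = g x" "x \<in> S"
    by (rule imageE)
  moreover have "Min (f ` S) \<le> f x" using \<open>x \<in> S\<close> assms(1) by simp
  ultimately show ?thesis using assms(3)[of x] by simp
qed (use assms(2) in simp)


section \<open>A linear-time program for the truncated weights\<close>

text \<open>
  Natural register 0 holds the number \<open>m\<close> of weights, register 1 counts the weights already processed,
  register 2 holds the constant 1, register 3 addresses the cell of the current difference, and
  register 4 is never written and serves as the address 0. Real register 0 holds \<open>\<epsilon>\<close>, register 1 the
  running sum, registers 2, 3 and 4 the current weight, its truncation and their difference;
  register 5 is never written, and adding it copies a register.

  Each round first increments the counter, so that the counter is the address of the current weight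
  (cell 0 is occupied by \<open>\<epsilon>\<close>) and \<open>m\<close> plus the counter is the address of the difference. Hence the
  truncated weight can overwrite the weight in place. The loop test is instruction 13; the sum is
  stored only after the loop.
\<close>

definition truncate_weights :: "ram_instr list" where
  "truncate_weights =
    [RLoad 0 1,
     ISet 2 1,
     Jump 13,
     IAdd 1 1 2,
     IAdd 3 0 1,
     RLoad 2 1,
     RAdd 3 2 5,
     RJumpLess 2 0 9,
     RAdd 3 0 5,
     RSub 4 2 3,
     RStore 1 3,
     RStore 3 4,
     RAdd 1 1 3,
     IJumpLess 1 0 3,
     RStore 4 1]"

text \<open>The state at the loop test after \<open>i\<close> rounds. Memory cell 0 is left open: \<open>\<epsilon>\<close> is already in a register,
  and the final store determines the cell.\<close>

definition loop_inv :: "real \<Rightarrow> real list \<Rightarrow> nat \<Rightarrow> ram_state \<Rightarrow> bool" where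
  "loop_inv \<epsilon> ws i s \<longleftrightarrow>
     counter s = 13 \<and>
     nreg s 0 = length ws \<and> nreg s 1 = i \<and> nreg s 2 = 1 \<and> nreg s 4 = 0 \<and>
     rreg s 0 = \<epsilon> \<and> rreg s 1 = (\<Sum>j<i. min \<epsilon> (ws ! j)) \<and> rreg s 5 = 0 \<and>
     (\<forall>j<i. memory s (1 + j) = min \<epsilon> (ws ! j) \<and>
             memory s (1 + length ws + j) = ws ! j - min \<epsilon> (ws ! j)) \<and>
     (\<forall>j. i \<le> j \<and> j < length ws \<longrightarrow> memory s (1 + j) = ws ! j)"

lemma truncate_weights_step:
  "k < 15 \<Longrightarrow> ram_step truncate_weights \<lparr>counter = k, nreg = N, rreg = R, memory = M\<rparr>
    = exec_instr (truncate_weights ! k) \<lparr>counter = k, nreg = N, rreg = R, memory = M\<rparr>"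
  by (simp add: ram_step_def ram_halted_def truncate_weights_def)

text \<open>The small indices are written with \<open>Suc\<close> because that is the form in which the simplifier
  produces these values of the program counter.\<close>

lemma truncate_weights_nth:
  "truncate_weights ! 0 = RLoad 0 1"
  "truncate_weights ! Suc 0 = ISet 2 1"
  "truncate_weights ! Suc (Suc 0) = Jump 13"
  "truncate_weights ! 3 = IAdd 1 1 2"
  "truncate_weights ! 4 = IAdd 3 0 1"
  "truncate_weights ! 5 = RLoad 2 1"
  "truncate_weights ! 6 = RAdd 3 2 5"
  "truncate_weights ! 7 = RJumpLess 2 0 9"
  "truncate_weights ! 8 = RAdd 3 0 5"
  "truncate_weights ! 9 = RSub 4 2 3"
  "truncate_weights ! 10 = RStore 1 3"
  "truncate_weights ! 11 = RStore 3 4"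
  "truncate_weights ! 12 = RAdd 1 1 3"
  "truncate_weights ! 13 = IJumpLess 1 0 3"
  "truncate_weights ! 14 = RStore 4 1"
  by (simp_all add: truncate_weights_def)

lemma funpow_numeral_apply:
  "(f ^^ numeral k) x = f ((f ^^ pred_numeral k) x)"
  by (simp add: numeral_eq_Suc)

lemmas truncate_weights_exec =
  funpow_numeral_apply truncate_weights_step truncate_weights_nth

lemma loop_inv_init:
  "loop_inv \<epsilon> ws 0 ((ram_step truncate_weights ^^ 3) (ram_input \<epsilon> ws))"
  by (simp add: truncate_weights_exec ram_input_def loop_inv_def)

lemma loop_inv_step:
  assumes inv: "loop_inv \<epsilon> ws i s" and i: "i < length ws"
  shows "\<exists>k\<le>11. loop_inv \<epsilon> ws (Suc i) ((ram_step truncate_weights ^^ k) s)"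
proof -
  obtain N R M where s: "s = \<lparr>counter = 13, nreg = N, rreg = R, memory = M\<rparr>"
    using inv by (cases s) (auto simp: loop_inv_def)
  have w: "M (Suc i) = ws ! i" using inv i by (auto simp: s loop_inv_def)
  show ?thesis
  proof (cases "ws ! i < \<epsilon>")
    case True
    \<comment> \<open>The conditional jump skips instruction 8, which saves one of the eleven steps.\<close>
    have "loop_inv \<epsilon> ws (Suc i) ((ram_step truncate_weights ^^ 10) s)"
      using inv i True w
      by (auto simp: truncate_weights_exec s loop_inv_def less_Suc_eq)
    then show ?thesis by (intro exI[of _ 10]) simp
  next
    case False
    have "loop_inv \<epsilon> ws (Suc i) ((ram_step truncate_weights ^^ 11) s)"
      using inv i False w
      by (auto simp: truncate_weights_exec s loop_inv_def less_Suc_eq)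
    then show ?thesis by (intro exI[of _ 11]) simp
  qed
qed

lemma loop_inv_reached:
  assumes "i \<le> length ws"
  shows "\<exists>k\<le>3 + 11 * i. loop_inv \<epsilon> ws i ((ram_step truncate_weights ^^ k) (ram_input \<epsilon> ws))"
  using assms
proof (induction i)
  case 0
  show ?case using loop_inv_init by (intro exI[of _ 3]) simp
next
  case (Suc i)
  then obtain k where k: "k \<le> 3 + 11 * i"
      "loop_inv \<epsilon> ws i ((ram_step truncate_weights ^^ k) (ram_input \<epsilon> ws))"
    by auto
  from loop_inv_step[OF k(2)] Suc.prems obtain l where "l \<le> 11"
      "loop_inv \<epsilon> ws (Suc i) ((ram_step truncate_weights ^^ (l + k)) (ram_input \<epsilon> ws))"
    by (auto simp: funpow_add)
  with k(1) show ?case by (intro exI[of _ "l + k"]) simp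
qed

text \<open>After the last round only the failing loop test and the store of the sum remain.\<close>

lemma truncate_weights_correct:
  "\<exists>s. ram_halts_within truncate_weights (11 * length ws + 5) (ram_input \<epsilon> ws) s \<and>
       ram_output s (\<Sum>j<length ws. min \<epsilon> (ws ! j))
         (map (min \<epsilon>) ws) (map (\<lambda>x. x - min \<epsilon> x) ws)"
proof -
  obtain k where k: "k \<le> 3 + 11 * length ws"
    "loop_inv \<epsilon> ws (length ws) ((ram_step truncate_weights ^^ k) (ram_input \<epsilon> ws))"
    (is "loop_inv _ _ _ ?s")
    using loop_inv_reached[of "length ws" ws \<epsilon>] by auto
  let ?t = "(ram_step truncate_weights ^^ 2) ?s"
  have s: "?s = \<lparr>counter = 13, nreg = nreg ?s, rreg = rreg ?s, memory = memory ?s\<rparr>"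
    using k(2) by (simp add: loop_inv_def)
  have t: "?t = \<lparr>counter = 15, nreg = nreg ?s, rreg = rreg ?s,
      memory = (memory ?s)(0 := \<Sum>j<length ws. min \<epsilon> (ws ! j))\<rparr>"
    using k(2) by (subst s) (simp add: truncate_weights_exec loop_inv_def)
  have "ram_halted truncate_weights ?t"
    unfolding t by (simp add: ram_halted_def truncate_weights_def)
  moreover have "?t = (ram_step truncate_weights ^^ (2 + k)) (ram_input \<epsilon> ws)"
    by (simp only: funpow_add o_apply)
  ultimately have "ram_halts_within truncate_weights (11 * length ws + 5) (ram_input \<epsilon> ws) ?t"
    unfolding ram_halts_within_def using k(1) by (intro exI[of _ "2 + k"]) simp
  moreover have "ram_output ?t (\<Sum>j<length ws. min \<epsilon> (ws ! j))
      (map (min \<epsilon>) ws) (map (\<lambda>x. x - min \<epsilon> x) ws)"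
    using k(2) by (simp add: t ram_output_def loop_inv_def)
  ultimately show ?thesis by blast
qed


section \<open>Upper bounds on the robust optimum\<close>

theorem lemma3p4:
  fixes G :: "('a, 'b) pre_digraph" and n :: nat and w c :: "'b \<Rightarrow> real" and \<epsilon> C :: real
  assumes "complete_digraph n G"
    and "\<forall>e\<in>arcs G. 0 \<le> w e"
    and "0 \<le> \<epsilon>"
    and "\<forall>e\<in>arcs G. c e = min \<epsilon> (w e)"
    and "C = (\<Sum>e\<in>arcs G. c e)"
  shows
    "(\<forall>H\<in>hamiltonian_cycles G.
        robust_cost w (uncertainty_L_inf G w \<epsilon>) H
          \<le> min ((\<Sum>e\<in>H. w e) + real n * \<epsilon>) (C + (\<Sum>e\<in>H. w e - c e)))
     \<and> opt_rtsp G w (uncertainty_L_inf G w \<epsilon>)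
          \<le> min (opt_tsp G w + real n * \<epsilon>) (C + opt_tsp G (\<lambda>e. w e - c e))
     \<and> (\<exists>P T. (\<lambda>m. real (T m)) \<in> O(\<lambda>m. real m) \<and>
          (\<forall>(G' :: ('a, 'b) pre_digraph) n' w' \<epsilon>' es.
             complete_digraph n' G' \<and> (\<forall>e\<in>arcs G'. 0 \<le> w' e) \<and> 0 \<le> \<epsilon>' \<and>
             distinct es \<and> set es = arcs G' \<longrightarrow>
             (\<exists>s. ram_halts_within P (T (card (arcs G'))) (ram_input \<epsilon>' (map w' es)) s \<and>
                  ram_output s
                    (\<Sum>e\<in>arcs G'. min \<epsilon>' (w' e))
                    (map (\<lambda>e. min \<epsilon>' (w' e)) es)
                    (map (\<lambda>e. w' e - min \<epsilon>' (w' e)) es))))"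
proof (intro conjI ballI)
  interpret graph G using assms(1) by (simp add: complete_digraph_def)
  let ?D = "uncertainty_L_inf G w \<epsilon>"
  have n: "card (verts G) = n" using assms(1) by (simp add: complete_digraph_def)
  have C: "C = (\<Sum>e\<in>arcs G. min \<epsilon> (w e))" using assms(4,5) by simp
  have C_nonneg: "0 \<le> C" using assms(2,3) by (auto simp: C intro!: sum_nonneg)
  show bound: "robust_cost w ?D H
      \<le> min ((\<Sum>e\<in>H. w e) + real n * \<epsilon>) (C + (\<Sum>e\<in>H. w e - c e))"
    if "H \<in> hamiltonian_cycles G" for H
  proof -
    note H = hamiltonian_cycle_subset_card[OF that]
    obtain p m where pm: "(p, m) \<in> ?D"
      and max: "robust_cost w ?D H = (\<Sum>e\<in>H. w e + p e - m e)"
      using robust_cost_attained[OF assms(2,3)] .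
    have "real (card H) * \<epsilon> \<le> real n * \<epsilon>"
      using H(2) n assms(3) by (intro mult_right_mono) auto
    then have "robust_cost w ?D H \<le> (\<Sum>e\<in>H. w e) + real n * \<epsilon>"
      using perturbed_cost_le_card[OF pm H(1)] max by linarith
    moreover have "(\<Sum>e\<in>H. w e - c e) = (\<Sum>e\<in>H. w e - min \<epsilon> (w e))"
      using H(1) assms(4) by (intro sum.cong) auto
    then have "robust_cost w ?D H \<le> C + (\<Sum>e\<in>H. w e - c e)"
      using perturbed_cost_le_truncation[OF pm H(1)] max C by simp
    ultimately show ?thesis by simp
  qed
  have "opt_rtsp G w ?D \<le> real n * \<epsilon> + opt_tsp G w"
    unfolding opt_rtsp_def opt_tsp_def
    using bound assms(3) by (intro Min_image_le_add finite_hamiltonian_cycles) (auto simp: add.commute)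
  moreover have "opt_rtsp G w ?D \<le> C + opt_tsp G (\<lambda>e. w e - c e)"
    unfolding opt_rtsp_def opt_tsp_def
    using bound C_nonneg by (intro Min_image_le_add finite_hamiltonian_cycles) auto
  ultimately show "opt_rtsp G w ?D
      \<le> min (opt_tsp G w + real n * \<epsilon>) (C + opt_tsp G (\<lambda>e. w e - c e))"
    by simp
next
  let ?T = "\<lambda>m::nat. 11 * m + 5"
  show "\<exists>P T. (\<lambda>m. real (T m)) \<in> O(\<lambda>m. real m) \<and>
          (\<forall>(G' :: ('a, 'b) pre_digraph) n' w' \<epsilon>' es.
             complete_digraph n' G' \<and> (\<forall>e\<in>arcs G'. 0 \<le> w' e) \<and> 0 \<le> \<epsilon>' \<and>
             distinct es \<and> set es = arcs G' \<longrightarrow>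
             (\<exists>s. ram_halts_within P (T (card (arcs G'))) (ram_input \<epsilon>' (map w' es)) s \<and>
                  ram_output s
                    (\<Sum>e\<in>arcs G'. min \<epsilon>' (w' e))
                    (map (\<lambda>e. min \<epsilon>' (w' e)) es)
                    (map (\<lambda>e. w' e - min \<epsilon>' (w' e)) es)))"
  proof (intro exI[of _ truncate_weights] exI[of _ ?T] conjI allI impI)
    \<comment> \<open>The constant 16 absorbs the additive 5 as soon as \<open>m \<ge> 1\<close>.\<close>
    have "\<forall>\<^sub>F m in sequentially. norm (real (?T m)) \<le> 16 * norm (real m)"
      using eventually_ge_at_top[of 1] by eventually_elim simp
    then show "(\<lambda>m. real (?T m)) \<in> O(\<lambda>m. real m)" by (rule bigoI)
  next
    fix G' :: "('a, 'b) pre_digraph" and n' and w' :: "'b \<Rightarrow> real" and \<epsilon>' :: real and es :: "'b list"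
    assume "complete_digraph n' G' \<and> (\<forall>e\<in>arcs G'. 0 \<le> w' e) \<and> 0 \<le> \<epsilon>' \<and>
      distinct es \<and> set es = arcs G'"
    then have es: "distinct es" "set es = arcs G'" by auto
    have "length es = card (arcs G')" using es distinct_card by metis
    moreover have "(\<Sum>e\<in>arcs G'. min \<epsilon>' (w' e)) = (\<Sum>j<length es. min \<epsilon>' (w' (es ! j)))"
      using es sum.distinct_set_conv_list[of es "\<lambda>e. min \<epsilon>' (w' e)"]
      by (simp add: sum_list_sum_nth atLeast0LessThan)
    ultimately show "\<exists>s. ram_halts_within truncate_weights (?T (card (arcs G')))
          (ram_input \<epsilon>' (map w' es)) s \<and>
        ram_output s (\<Sum>e\<in>arcs G'. min \<epsilon>' (w' e))
          (map (\<lambda>e. min \<epsilon>' (w' e)) es) (map (\<lambda>e. w' e - min \<epsilon>' (w' e)) es)"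
      using truncate_weights_correct[of "map w' es" \<epsilon>'] by (simp add: comp_def)
  qed
qed

end
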